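(* Let $n\geq1$ be an integer, let $f\in\mathcal{A}_n$ with $f(z)\neq0$ for $z\in\mathbb{U}\setminus\{0\}$, let $\mu\in\mathbb{C}$ with $\mu\neq 0$ and $\operatorname{Re}(\mu)<n/2$, and let $\lambda\in\mathbb{C}$ with $\lambda\neq0$ be such that $$f'(z)\left(\frac{z}{f(z)}\right)^{1+\mu}\prec 1+\lambda z\qquad(z\in\mathbb{U}).$$ Put $\ell_1=|\lambda|\,\dfrac{|\mu|}{|n-\mu|}$. Then: (1) If $0<|\lambda|\leq\dfrac{|n-\mu|}{\sqrt{|n-\mu|^2+|\mu|^2}}$, then $\operatorname{Re}\big(zf'(z)/f(z)\big)>\alpha_0$ for all $z\in\mathbb{U}$ (so $f\in\mathcal{S}^*(\alpha)$ for every $\alpha$ with $0\le\alpha\leq\alpha_0$), where $$\alpha_0=\begin{cases}\dfrac{1-|\lambda|}{1+\ell_1}, & \text{if } 0<|\lambda|\leq\dfrac{|n-\mu|}{|n-\mu|+|\mu|},\\[2mm] \dfrac{1-(|\lambda|^2+\ell_1^2)}{2(1-\ell_1^2)}, & \text{if } \dfrac{|n-\mu|}{|n-\mu|+|\mu|}\leq|\lambda|\leq\dfrac{|n-\mu|}{\sqrt{|n-\mu|^2+|\mu|^2}}.\end{cases}$$ (2) If $0<|\lambda|\leq\dfrac{|n-\mu|}{|n-\mu|+2|\mu|}$, then $$\left|\frac{zf'(z)}{f(z)}-1\right|<\frac{(|n-\mu|+|\mu|)\,|\lambda|}{|n-\mu|-|\mu|\,|\lambda|}\leq1\qquad(z\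in\mathbb{U}).$$
   Context: $\mathbb{U}=\{z\in\mathbb{C}:|z|<1\}$. For an integer $n\geq1$, $\mathcal{A}_n$ is the class of functions $f(z)=z+a_{n+1}z^{n+1}+a_{n+2}z^{n+2}+\cdots$ analytic in $\mathbb{U}$ with $a_{n+1}\neq0$. For $0\leq\alpha<1$, $f\in\mathcal{A}_n$ is in $\mathcal{S}^*(\alpha)$ (starlike of order $\alpha$) if $\operatorname{Re}(zf'(z)/f(z))>\alpha$ on $\mathbb{U}$. Powers such as $(z/f(z))^{\mu}$ are defined as $\exp(\mu\log(z/f(z)))$ using the branch of $\log(z/f(z))$ (analytic on $\mathbb{U}$) that equals $0$ at $z=0$. For $F,G$ analytic in $\mathbb{U}$, $F\prec G$ means there is an analytic $w$ in $\mathbb{U}$ with $w(0)=0$, $|w(z)|<1$, and $F=G\circ w$; for $\lambda\neq0$, $q\prec1+\lambda z$ means $q(0)=1$ and $|q(z)-1|<|\lambda|$ on $\mathbb{U}$. *)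

theory Defs
  imports "HOL-Analysis.Analysis"
begin

abbreviation unit_disc :: "complex set" where
  "unit_disc \<equiv> ball 0 1"

text \<open>Class A_n: f(z) = z + a_(n+1) z^(n+1) + ... analytic in the unit disc with
  a_(n+1) nonzero. The Taylor coefficients are a_k = f^(k)(0)/k!.\<close>
definition class_A :: "nat \<Rightarrow> (complex \<Rightarrow> complex) \<Rightarrow> bool" where
  "class_A n f \<longleftrightarrow> f holomorphic_on unit_disc \<and> f 0 = 0 \<and> deriv f 0 = 1 \<and>
     (\<forall>k. 2 \<le> k \<and> k \<le> n \<longrightarrow> (deriv ^^ k) f 0 = 0) \<and>
     (deriv ^^ (Suc n)) f 0 \<noteq> 0"

text \<open>z/f(z), extended analytically by its value 1 at z = 0.\<close>
definition z_over_f :: "(complex \<Rightarrow> complex) \<Rightarrow> complex \<Rightarrow> complex" where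
  "z_over_f f z = (if z = 0 then 1 else z / f z)"

definition log_branch :: "(complex \<Rightarrow> complex) \<Rightarrow> (complex \<Rightarrow> complex) \<Rightarrow> bool" where
  "log_branch f L \<longleftrightarrow> L holomorphic_on unit_disc \<and> L 0 = 0 \<and>
     (\<forall>z\<in>unit_disc. exp (L z) = z_over_f f z)"

text \<open>z f'(z)/f(z), extended analytically by its value 1 at z = 0.\<close>
definition starlike_quot :: "(complex \<Rightarrow> complex) \<Rightarrow> complex \<Rightarrow> complex" where
  "starlike_quot f z = (if z = 0 then 1 else z * deriv f z / f z)"

text \<open>q \<prec> 1 + \<lambda> z (as defined in the context, for \<lambda> \<noteq> 0).\<close>
definition subord_lin :: "(complex \<Rightarrow> complex) \<Rightarrow> complex \<Rightarrow> bool" where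
  "subord_lin q lam \<longleftrightarrow> q 0 = 1 \<and> (\<forall>z\<in>unit_disc. cmod (q z - 1) < cmod lam)"

end

theory Submission
  imports Defs "HOL-Complex_Analysis.Conformal_Mappings"
begin

text \<open>
  Put \<open>P = (z/f)\<^sup>\<mu>\<close> and \<open>q = f' (z/f)\<^bsup>1+\<mu>\<^esup>\<close>. Then \<open>z f'/f = q/P\<close> and
  \<open>q = P - z P'/\<mu>\<close>, and \<open>P - 1\<close> vanishes at \<open>0\<close> to order at least \<open>n\<close>.
  If \<open>|P - 1|\<close> reached \<open>\<ell>\<^sub>1\<close>, Jack's lemma would give a point \<open>z\<^sub>0\<close> where
  \<open>|P - 1| \<ge> \<ell>\<^sub>1\<close> and \<open>z\<^sub>0 P' = c (P - 1)\<close> with \<open>c \<ge> n\<close> real, whence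
  \<open>|q - 1| = |P - 1| |c - \<mu>|/|\<mu>| \<ge> |\<lambda>|\<close>, a contradiction. So \<open>|P - 1| < \<ell>\<^sub>1\<close> and
  \<open>|q - 1| < |\<lambda>|\<close>, and it remains to bound \<open>q/P\<close> for \<open>q\<close> and \<open>P\<close> in these discs.
\<close>

section \<open>Factoring powers of \<open>z\<close> out of functions holomorphic in the disc\<close>

lemma factor_zero_at_origin:
  assumes F: "F holomorphic_on unit_disc" and F0: "F 0 = 0"
  shows "\<exists>u. u holomorphic_on unit_disc \<and> (\<forall>z. F z = z * u z)"
proof (intro exI conjI)
  show "(\<lambda>z. if z = 0 then deriv F 0 else (F z - F 0) / (z - 0)) holomorphic_on unit_disc"
    by (rule pole_lemma_open[OF F]) simp
  show "\<forall>z. F z = z * (if z = 0 then deriv F 0 else (F z - F 0) / (z - 0))"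
    using F0 by auto
qed

lemma DERIV_power_Suc_mult:
  fixes u :: "complex \<Rightarrow> complex"
  assumes "(u has_field_derivative D) (at z)"
  shows "((\<lambda>z. z ^ Suc k * u z) has_field_derivative
           of_nat (Suc k) * z ^ k * u z + z ^ Suc k * D) (at z)"
proof -
  have "((\<lambda>z. z ^ Suc k) has_field_derivative of_nat (Suc k) * z ^ k) (at z)"
    using DERIV_power_Suc[OF DERIV_ident, of k z UNIV] by simp
  from DERIV_mult[OF this assms] show ?thesis
    by (simp only: mult.commute)
qed

text \<open>If \<open>F = z^(k+1) u\<close> with \<open>k < n\<close>, differentiating and dividing
  by \<open>z^k\<close> gives \<open>(k+1) u + z u' = z^(n-k) g\<close> off the origin. By
  continuity this persists at \<open>0\<close>, so \<open>u 0 = 0\<close> and one more factor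
  \<open>z\<close> splits off.\<close>

lemma factor_power_of_deriv:
  assumes F: "F holomorphic_on unit_disc" and F0: "F 0 = 0"
    and g: "g holomorphic_on unit_disc"
    and dF: "\<And>z. z \<in> unit_disc \<Longrightarrow> deriv F z = z ^ n * g z"
  shows "\<exists>u. u holomorphic_on unit_disc \<and> (\<forall>z\<in>unit_disc. F z = z ^ Suc n * u z)"
proof -
  have "k \<le> n \<Longrightarrow> \<exists>u. u holomorphic_on unit_disc \<and> (\<forall>z\<in>unit_disc. F z = z ^ Suc k * u z)" for k
  proof (induction k)
    case 0
    then show ?case using factor_zero_at_origin[OF F F0] by auto
  next
    case (Suc k)
    then obtain u where u: "u holomorphic_on unit_disc"
      and Fu: "\<And>z. z \<in> unit_disc \<Longrightarrow> F z = z ^ Suc k * u z" by auto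
    define H where "H z = of_nat (Suc k) * u z + z * deriv u z - z ^ (n - k) * g z" for z
    have H: "H holomorphic_on unit_disc"
      unfolding H_def by (intro holomorphic_intros u g) auto
    have "H z = 0" if z: "z \<in> unit_disc" "z \<noteq> 0" for z
    proof -
      note DERIV_power_Suc_mult[OF holomorphic_derivI[OF u open_ball z(1)]]
      then have "(F has_field_derivative
              of_nat (Suc k) * z ^ k * u z + z ^ Suc k * deriv u z) (at z)"
        by (rule has_field_derivative_transform_within_open[OF _ open_ball z(1)]) (use Fu in auto)
      then have "z ^ k * (of_nat (Suc k) * u z + z * deriv u z) = z ^ n * g z"
        using dF[OF z(1)] by (simp add: DERIV_imp_deriv algebra_simps)
      moreover have "z ^ n = z ^ k * z ^ (n - k)"
        using Suc.prems by (simp flip: power_add)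
      ultimately show ?thesis using z(2) by (simp add: H_def)
    qed
    then have "\<forall>\<^sub>F z in at 0. H z = 0"
      by (auto simp: eventually_at_topological intro!: exI[of _ unit_disc])
    moreover have "H \<midarrow>0\<rightarrow> H 0"
      using holomorphic_on_imp_continuous_on[OF H] by (simp add: continuous_on_eq_continuous_at isCont_def)
    ultimately have "H 0 = 0"
      by (metis tendsto_unique tendsto_eventually trivial_limit_at)
    \<comment> \<open>Here \<open>n - k \<ge> 1\<close>, so \<open>H 0\<close> reduces to
      \<open>(k+1) * u 0\<close>.\<close>
    moreover have "(0::complex) ^ (n - k) = 0" using Suc.prems by simp
    ultimately have "u 0 = 0" by (simp add: H_def del: of_nat_Suc power_eq_0_iff)
    then obtain v where "v holomorphic_on unit_disc" "\<And>z. u z = z * v z"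
      using factor_zero_at_origin[OF u] by auto
    then show ?case using Fu by (intro exI[of _ v]) (auto simp: algebra_simps)
  qed
  then show ?thesis by auto
qed

text \<open>The induction factors \<open>deriv F\<close>, whose derivatives at \<open>0\<close> are
  those of \<open>F\<close> shifted by one; \<open>factor_power_of_deriv\<close> then gains the
  missing power.\<close>

lemma factor_power_of_higher_deriv:
  assumes "F holomorphic_on unit_disc" "\<And>k. k < n \<Longrightarrow> (deriv ^^ k) F 0 = 0"
  shows "\<exists>u. u holomorphic_on unit_disc \<and> (\<forall>z\<in>unit_disc. F z = z ^ n * u z)"
  using assms
proof (induction n arbitrary: F)
  case 0
  then show ?case by auto
next
  case (Suc n)
  have "(deriv ^^ k) (deriv F) 0 = 0" if "k < n" for k
    using Suc.prems(2)[of "Suc k"] that by (simp add: funpow_swap1)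
  then obtain g where "g holomorphic_on unit_disc" "\<forall>z\<in>unit_disc. deriv F z = z ^ n * g z"
    using Suc.IH[of "deriv F"] holomorphic_deriv[OF Suc.prems(1)] by auto
  then show ?case
    using factor_power_of_deriv[of F g n] Suc.prems(1) Suc.prems(2)[of 0] by auto
qed

section \<open>Jack's lemma on \<open>z W'/W\<close> at a point of maximum modulus\<close>

text \<open>
  Moving from \<open>z0\<close> in any direction \<open>z0 * s\<close> with \<open>Re s < 0\<close> stays in the disc, so \<open>|u|\<close> cannot
  increase to first order: \<open>Re (c * s) \<le> 0\<close> for all such \<open>s\<close>, which forces \<open>c\<close> to be real and
  nonnegative.
\<close>
lemma jack_boundary_derivative:
  assumes u: "u holomorphic_on unit_disc" and z0: "z0 \<in> unit_disc"
    and max: "\<And>z. cmod z \<le> cmod z0 \<Longrightarrow> cmod (u z) \<le> cmod (u z0)"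
    and nz: "u z0 \<noteq> 0"
  shows "\<exists>c\<ge>0. z0 * deriv u z0 = of_real c * u z0"
proof -
  define c where "c = z0 * deriv u z0 / u z0"
  have key: "Re (c * s) \<le> 0" if s: "Re s < 0" for s
  proof (rule ccontr)
    assume "\<not> ?thesis"
    then have pos: "Re (c * s) > 0" by simp
    define \<phi> where "\<phi> t = Re (u (z0 * (1 + of_real t * s)) / u z0)" for t :: real
    have "((\<lambda>w. z0 * (1 + w * s)) has_field_derivative z0 * s) (at 0)"
      by (auto intro!: derivative_eq_intros)
    then have "((\<lambda>w. u (z0 * (1 + w * s))) has_field_derivative deriv u z0 * (z0 * s)) (at 0)"
      using DERIV_chain2[of u "deriv u z0" "\<lambda>w. z0 * (1 + w * s)" 0 "z0 * s" UNIV]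
        holomorphic_derivI[OF u open_ball z0] by simp
    from DERIV_cdivide[OF this, of "u z0"]
    have "((\<lambda>w. u (z0 * (1 + w * s)) / u z0) has_field_derivative c * s) (at (of_real 0))"
      by (simp add: c_def mult_ac)
    then have "(\<phi> has_real_derivative Re (c * s)) (at 0)"
      unfolding \<phi>_def has_real_derivative_iff_has_vector_derivative
      by (intro bounded_linear.has_vector_derivative[OF bounded_linear_Re]
          has_vector_derivative_real_field)
    from DERIV_pos_inc_right[OF this pos] obtain d
      where d: "d > 0" "\<And>h. 0 < h \<Longrightarrow> h < d \<Longrightarrow> \<phi> 0 < \<phi> h" by auto
    \<comment> \<open>\<open>h < d\<close> preserves the increase of \<open>\<phi>\<close>; the
      other bound makes \<open>2 * Re s + h * |s|^2\<close> negative, so \<open>1 + h * s\<close>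
      has modulus at most 1.\<close>
    define h where "h = min (d / 2) (- Re s / (cmod s)\<^sup>2)"
    have sn: "cmod s > 0" using s by auto
    have h: "0 < h" "h < d" "h * (cmod s)\<^sup>2 \<le> - Re s"
      using d(1) s sn by (auto simp: h_def min_def field_simps)
    have "(cmod (1 + of_real h * s))\<^sup>2 = 1 + h * (2 * Re s + h * (cmod s)\<^sup>2)"
      unfolding cmod_power2 by (simp add: power2_eq_square algebra_simps)
    also have "\<dots> \<le> 1" using h s by (simp add: mult_nonneg_nonpos)
    finally have "cmod (1 + of_real h * s) \<le> 1" by (simp add: abs_square_le_1)
    then have "cmod (u (z0 * (1 + of_real h * s))) \<le> cmod (u z0)"
      by (intro max) (simp add: norm_mult mult_left_le)
    then have "cmod (u (z0 * (1 + of_real h * s)) / u z0) \<le> 1"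
      using nz by (simp add: norm_divide)
    then have "\<phi> h \<le> 1"
      unfolding \<phi>_def using complex_Re_le_cmod order_trans by blast
    moreover have "\<phi> 0 = 1" using nz by (simp add: \<phi>_def)
    ultimately show False using d(2)[OF h(1,2)] by simp
  qed
  have re: "Re c \<ge> 0" using key[of "-1"] by simp
  have im: "\<bar>Im c\<bar> \<le> 0 + e" if "e > 0" for e
  proof -
    \<comment> \<open>The directions \<open>-d + i\<close> and \<open>-d - i\<close> give
      \<open>|Im c| \<le> d * Re c\<close>; the 1 in the denominator covers
      \<open>Re c = 0\<close>.\<close>
    define d where "d = e / (1 + Re c)"
    have d: "d > 0" "d * Re c \<le> e" using that re by (auto simp: d_def field_simps)
    show ?thesis using key[of "Complex (-d) 1"] key[of "Complex (-d) (-1)"] d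
      by (auto simp: mult.commute)
  qed
  have "Im c = 0" using field_le_epsilon[of "\<bar>Im c\<bar>" 0] im by simp
  then have "c = of_real (Re c)" by (simp add: complex_eq_iff)
  then have "z0 * deriv u z0 = of_real (Re c) * u z0"
    using nz by (metis c_def nonzero_eq_divide_eq)
  with re show ?thesis by blast
qed

text \<open>Let \<open>z0\<close> maximize \<open>|u|\<close> on the circle through
  \<open>z1\<close>. There \<open>|z^n|\<close> is constant, so \<open>z0\<close> maximizes
  \<open>|W|\<close> as well. By the maximum principle \<open>jack_boundary_derivative\<close>
  applies to \<open>u\<close>, and the factor \<open>z^n\<close> adds \<open>n\<close> to
  \<open>z0 u'/u\<close>.\<close>

lemma jack_lemma:
  assumes u: "u holomorphic_on unit_disc" and W: "\<And>z. z \<in> unit_disc \<Longrightarrow> W z = z ^ n * u z"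
    and z1: "z1 \<in> unit_disc" "z1 \<noteq> 0" "W z1 \<noteq> 0"
  obtains z0 c where "z0 \<in> unit_disc" "cmod (W z0) \<ge> cmod (W z1)" "c \<ge> real n"
    "z0 * deriv W z0 = of_real c * W z0"
proof -
  let ?r = "cmod z1"
  have r: "0 < ?r" "?r < 1" using z1 by auto
  have sub: "cball 0 ?r \<subseteq> unit_disc" using r by auto
  have cu: "continuous_on (cball 0 ?r) u"
    using holomorphic_on_imp_continuous_on[OF u] sub continuous_on_subset by blast
  have "continuous_on (sphere 0 ?r) (\<lambda>z. cmod (u z))"
    using cu by (intro continuous_on_norm) (auto elim: continuous_on_subset)
  then obtain z0 where z0: "cmod z0 = ?r"
    and m: "\<And>z. cmod z = ?r \<Longrightarrow> cmod (u z) \<le> cmod (u z0)"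
    using continuous_attains_sup[of "sphere 0 ?r" "\<lambda>z. cmod (u z)"] z1 by fastforce
  have z0d: "z0 \<in> unit_disc" using z0 r by simp
  have max: "cmod (u z) \<le> cmod (u z0)" if "cmod z \<le> cmod z0" for z
  proof (rule maximum_modulus_frontier[of u "cball 0 ?r"])
    show "u holomorphic_on interior (cball 0 ?r)"
      using u sub by (meson holomorphic_on_subset interior_subset order_trans)
  qed (use cu m that z0 in auto)
  have le: "cmod (W z1) \<le> cmod (W z0)"
    using m[of z1] W[OF z1(1)] W[OF z0d] z0 by (simp add: norm_mult norm_power mult_left_mono)
  then have "u z0 \<noteq> 0" using z1(3) W[OF z0d] by auto
  then obtain c where c: "c \<ge> 0" "z0 * deriv u z0 = of_real c * u z0"
    using jack_boundary_derivative[OF u z0d max] by auto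
  have "((\<lambda>z. z ^ n * u z) has_field_derivative
          of_nat n * z0 ^ (n - 1) * u z0 + z0 ^ n * deriv u z0) (at z0)"
    using holomorphic_derivI[OF u open_ball z0d]
    by (auto intro!: derivative_eq_intros)
  then have "(W has_field_derivative
          of_nat n * z0 ^ (n - 1) * u z0 + z0 ^ n * deriv u z0) (at z0)"
    by (rule has_field_derivative_transform_within_open[OF _ open_ball z0d]) (use W in auto)
  then have "z0 * deriv W z0 = of_nat n * (z0 * z0 ^ (n - 1)) * u z0 + z0 ^ n * (z0 * deriv u z0)"
    by (simp add: DERIV_imp_deriv algebra_simps)
  also have "of_nat n * (z0 * z0 ^ (n - 1)) = of_nat n * z0 ^ n" by (cases n) auto
  finally have "z0 * deriv W z0 = of_real (real n + c) * W z0"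
    using c(2) W[OF z0d] by (simp add: algebra_simps)
  then show ?thesis using that[of z0 "real n + c"] z0d le c(1) by simp
qed

section \<open>The functions \<open>L\<close> and \<open>P = exp (mu * L)\<close>\<close>

text \<open>Writing \<open>f = z (1 + z^n h)\<close> gives \<open>exp L * (1 + z^n h) = 1\<close>.
  Differentiating shows that \<open>z^(n-1)\<close> divides \<open>L'\<close>, hence also
  \<open>P'\<close>, and \<open>factor_power_of_deriv\<close> restores the last power.\<close>

lemma log_branch_power_factor:
  assumes f: "class_A n f" and n: "n \<ge> 1"
    and fnz: "\<forall>z\<in>unit_disc - {0}. f z \<noteq> 0" and L: "log_branch f L"
  shows "\<exists>u. u holomorphic_on unit_disc \<and> (\<forall>z\<in>unit_disc. exp (mu * L z) - 1 = z ^ n * u z)"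
proof -
  have Lh: "L holomorphic_on unit_disc" and L0: "L 0 = 0"
    and Le: "\<And>z. z \<in> unit_disc \<Longrightarrow> exp (L z) = z_over_f f z"
    using L by (auto simp: log_branch_def)
  have fh: "f holomorphic_on unit_disc" and f0: "f 0 = 0" and f1: "deriv f 0 = 1"
    and fk: "\<And>k. 2 \<le> k \<Longrightarrow> k \<le> n \<Longrightarrow> (deriv ^^ k) f 0 = 0"
    using f by (auto simp: class_A_def)
  have "(deriv ^^ k) (\<lambda>z. f z - z) 0 = 0" if k: "k < Suc n" for k
  proof -
    have "(deriv ^^ k) (\<lambda>z. f z - z) 0 = (deriv ^^ k) f 0 - (deriv ^^ k) (\<lambda>z. z) 0"
      by (rule higher_deriv_diff[OF fh]) (auto intro: holomorphic_intros)
    then show ?thesis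
      using f0 f1 fk[of k] k by (cases "k < 2") (auto simp: less_2_cases_iff)
  qed
  then obtain h where h: "h holomorphic_on unit_disc"
    and fh: "\<And>z. z \<in> unit_disc \<Longrightarrow> f z - z = z ^ Suc n * h z"
    using factor_power_of_higher_deriv[of "\<lambda>z. f z - z" "Suc n"]
      holomorphic_on_diff[OF fh holomorphic_on_ident] by blast
  obtain m where m: "n = Suc m" using n by (cases n) auto
  have eG: "exp (L z) * (1 + z ^ n * h z) = 1" if z: "z \<in> unit_disc" for z
  proof (cases "z = 0")
    case True
    then show ?thesis using L0 m by simp
  next
    case False
    have "f z = z * (1 + z ^ n * h z)" using fh[OF z] by (simp add: algebra_simps)
    moreover have "f z \<noteq> 0" using fnz z False by auto
    ultimately show ?thesis using Le[OF z] False by (simp add: z_over_f_def)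
  qed
  define g where "g z = - (mu * exp (mu * L z) * exp (L z) * (of_nat n * h z + z * deriv h z))" for z
  have g: "g holomorphic_on unit_disc"
    unfolding g_def by (intro holomorphic_intros h Lh) auto
  have "deriv (\<lambda>z. exp (mu * L z) - 1) z = z ^ m * g z" if z: "z \<in> unit_disc" for z
  proof -
    note dL = holomorphic_derivI[OF Lh open_ball z]
    note dh = holomorphic_derivI[OF h open_ball z]
    have "((\<lambda>z. exp (L z) * (1 + z ^ n * h z)) has_field_derivative
        exp (L z) * deriv L z * (1 + z ^ n * h z)
        + exp (L z) * (of_nat n * z ^ m * h z + z ^ n * deriv h z)) (at z)"
      unfolding m
      by (rule DERIV_cong, (rule derivative_intros dL DERIV_power_Suc_mult dh)+)
        (simp add: algebra_simps)
    moreover have "((\<lambda>z. exp (L z) * (1 + z ^ n * h z)) has_field_derivative 0) (at z)"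
      by (rule has_field_derivative_transform_within_open[OF DERIV_const[of 1] open_ball z])
        (use eG in auto)
    ultimately have "exp (L z) * deriv L z * (1 + z ^ n * h z)
        + exp (L z) * (of_nat n * z ^ m * h z + z ^ n * deriv h z) = 0"
      by (rule DERIV_unique)
    moreover have "exp (L z) * deriv L z * (1 + z ^ n * h z) = deriv L z * (exp (L z) * (1 + z ^ n * h z))"
      by (simp only: mult_ac)
    ultimately have dLz: "deriv L z = - (exp (L z) * (of_nat n * z ^ m * h z + z ^ n * deriv h z))"
      unfolding eG[OF z] by (simp add: eq_neg_iff_add_eq_0)
    have "exp (mu * L z) * (mu * deriv L z) = z ^ m * g z"
      unfolding g_def dLz m by (simp add: algebra_simps)
    moreover have "((\<lambda>z. exp (mu * L z) - 1) has_field_derivative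
        exp (mu * L z) * (mu * deriv L z)) (at z)"
      by (auto intro!: derivative_eq_intros dL)
    ultimately show ?thesis by (simp add: DERIV_imp_deriv)
  qed
  then show ?thesis unfolding m
    by (intro factor_power_of_deriv[where g = g]) (use L0 g Lh in \<open>auto intro!: holomorphic_intros\<close>)
qed

text \<open>Off the origin this is the derivative of \<open>exp L * f = z\<close>. It yields
  \<open>z P' = mu (P - q)\<close>, the link between \<open>P\<close> and \<open>q\<close>.\<close>

lemma mult_deriv_log_branch:
  assumes f: "f holomorphic_on unit_disc"
    and fnz: "\<forall>z\<in>unit_disc - {0}. f z \<noteq> 0" and L: "log_branch f L"
    and z: "z \<in> unit_disc"
  shows "z * deriv L z = 1 - starlike_quot f z"
proof (cases "z = 0")
  case True
  then show ?thesis by (simp add: starlike_quot_def)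
next
  case False
  have Lh: "L holomorphic_on unit_disc"
    and Le: "\<And>z. z \<in> unit_disc \<Longrightarrow> exp (L z) = z_over_f f z"
    using L by (auto simp: log_branch_def)
  have fz: "f z \<noteq> 0" using fnz z False by auto
  have zs: "z \<in> unit_disc - {0}" and op: "open (unit_disc - {0::complex})" using z False by auto
  have "((\<lambda>z. exp (L z) * f z) has_field_derivative
      exp (L z) * deriv L z * f z + exp (L z) * deriv f z) (at z)"
    by (auto intro!: derivative_eq_intros holomorphic_derivI[OF Lh open_ball z]
        holomorphic_derivI[OF f open_ball z])
  moreover have "((\<lambda>z. exp (L z) * f z) has_field_derivative 1) (at z)"
    by (rule has_field_derivative_transform_within_open[OF DERIV_ident op zs])
      (use Le fnz in \<open>auto simp: z_over_f_def\<close>)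
  ultimately have "exp (L z) * deriv L z * f z + exp (L z) * deriv f z = 1"
    by (rule DERIV_unique)
  then have "z * deriv L z + z * deriv f z / f z = 1"
    using Le[OF z] False fz by (simp add: z_over_f_def field_simps)
  then show ?thesis using False by (simp add: starlike_quot_def algebra_simps)
qed

section \<open>Lower bounds for \<open>Re (q / P)\<close> with \<open>q\<close> and \<open>P\<close>
  in discs about 1\<close>

text \<open>
  The right-hand side is a quadratic in \<open>r = 1/|P|\<close> with vertex at \<open>l / (1 - l1\<^sup>2)\<close>. When
  \<open>l + l1 \<le> 1\<close>, the vertex lies to the left of the least possible value \<open>1 / (1 + l1)\<close> of \<open>r\<close>;
  this is why the theorem distinguishes two cases.
\<close>
lemma Re_divide_gt:
  assumes q: "cmod (q - 1) < l" and P: "cmod (P - 1) \<le> l1" and l1: "l1 < 1"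
  shows "Re (q / P) > (1 + (1 - l1\<^sup>2) * (inverse (cmod P))\<^sup>2) / 2 - l * inverse (cmod P)"
proof -
  have P0: "P \<noteq> 0" using P l1 by auto
  define w where "w = inverse P"
  have w0: "cmod w > 0" using P0 by (simp add: w_def)
  \<comment> \<open>The disc condition on \<open>P\<close> becomes
    \<open>|1 - w| \<le> l1 * |w|\<close>; squaring it bounds \<open>Re w\<close> below by
    \<open>|w|\<close> alone.\<close>
  have "cmod (1 - w) = cmod w * cmod (P - 1)"
    using P0 by (simp add: w_def field_simps flip: norm_mult)
  then have "(cmod (1 - w))\<^sup>2 \<le> (cmod w * l1)\<^sup>2"
    using P by (intro power_mono) (auto intro: mult_left_mono)
  moreover have "(cmod (1 - w))\<^sup>2 = 1 - 2 * Re w + (cmod w)\<^sup>2"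
    unfolding cmod_power2 by (simp add: power2_eq_square algebra_simps)
  ultimately have "Re w \<ge> (1 + (1 - l1\<^sup>2) * (cmod w)\<^sup>2) / 2"
    by (simp add: power_mult_distrib algebra_simps)
  moreover have "q / P = w + (q - 1) * w" by (simp add: w_def divide_inverse algebra_simps)
  then have "Re (q / P) = Re w + Re ((q - 1) * w)" by (simp only: plus_complex.sel)
  moreover have "Re ((q - 1) * w) \<ge> - (cmod (q - 1) * cmod w)"
    using abs_Re_le_cmod[of "(q - 1) * w"] by (simp add: norm_mult)
  moreover have "cmod (q - 1) * cmod w < l * cmod w" using q w0 by simp
  ultimately have "Re (q / P) > (1 + (1 - l1\<^sup>2) * (cmod w)\<^sup>2) / 2 - l * cmod w" by linarith
  then show ?thesis by (simp add: w_def norm_inverse)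
qed

text \<open>To the right of its vertex the quadratic increases, so its least value is attained at
  \<open>r0 = 1 / (1 + l1)\<close>.\<close>

lemma Re_divide_gt_small:
  assumes q: "cmod (q - 1) < l" and P: "cmod (P - 1) \<le> l1" and l: "0 < l" "l + l1 \<le> 1"
  shows "Re (q / P) > (1 - l) / (1 + l1)"
proof -
  have l1: "0 \<le> l1" "l1 < 1" using l P order_trans[OF norm_ge_zero P] by auto
  have "P \<noteq> 0" using P l1 by auto
  define r where "r = inverse (cmod P)"
  have "cmod P \<le> 1 + l1" using norm_triangle_ineq[of "P - 1" 1] P by simp
  then have r: "r \<ge> 1 / (1 + l1)" using \<open>P \<noteq> 0\<close> l1 by (simp add: r_def field_simps)
  define r0 where "r0 = 1 / (1 + l1)"
  have e: "(1 - l1\<^sup>2) * r0 = 1 - l1" "(1 + l1) * r0 = 1"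
    using l1 by (auto simp: r0_def power2_eq_square field_simps)
  \<comment> \<open>This product is twice the difference of the quadratic at \<open>r\<close> and
    \<open>r0\<close>.\<close>
  have "(r - r0) * ((1 - l1\<^sup>2) * (r + r0) - 2 * l) \<ge> 0"
  proof (rule mult_nonneg_nonneg)
    have "(1 - l1\<^sup>2) * r \<ge> (1 - l1\<^sup>2) * r0"
      using r l1 by (intro mult_left_mono) (auto simp: r0_def abs_square_le_1)
    then show "0 \<le> (1 - l1\<^sup>2) * (r + r0) - 2 * l" using e(1) l by (simp add: distrib_left)
  qed (use r in \<open>simp add: r0_def\<close>)
  moreover have "(r - r0) * ((1 - l1\<^sup>2) * (r + r0) - 2 * l)
      = (1 - l1\<^sup>2) * r\<^sup>2 - 2 * l * r - (((1 - l1\<^sup>2) * r0) * r0 - 2 * l * r0)"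
    by (simp add: power2_eq_square algebra_simps)
  moreover have "1 + ((1 - l1) * r0 - 2 * l * r0) = 2 * ((1 - l) * r0)"
    using e(2) by (simp add: algebra_simps)
  ultimately have "2 * ((1 - l) * r0) \<le> 1 + ((1 - l1\<^sup>2) * r\<^sup>2 - 2 * l * r)"
    unfolding e(1) by linarith
  then have "(1 + (1 - l1\<^sup>2) * r\<^sup>2) / 2 - l * r \<ge> (1 - l) * r0" by argo
  then show ?thesis using Re_divide_gt[OF q P l1(2)] by (simp add: r_def r0_def)
qed

text \<open>The bound is the value of the quadratic at its vertex, obtained by completing the
  square.\<close>

lemma Re_divide_gt_large:
  assumes q: "cmod (q - 1) < l" and P: "cmod (P - 1) \<le> l1" and l1: "l1 < 1"
  shows "Re (q / P) > (1 - (l\<^sup>2 + l1\<^sup>2)) / (2 * (1 - l1\<^sup>2))"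
proof -
  define k where "k = 1 - l1\<^sup>2"
  define r where "r = inverse (cmod P)"
  have "0 \<le> l1" using order_trans[OF norm_ge_zero P] .
  then have k: "k > 0" using l1 by (simp add: k_def abs_square_less_1)
  have "(k * r - l)\<^sup>2 \<ge> 0" by simp
  then have "(k - l\<^sup>2) / (2 * k) \<le> (1 + k * r\<^sup>2) / 2 - l * r"
    using k by (simp add: field_simps power2_eq_square)
  also have "\<dots> < Re (q / P)" using Re_divide_gt[OF q P l1] by (simp add: k_def r_def)
  finally show ?thesis by (simp add: k_def algebra_simps)
qed

section \<open>The estimate of \<open>P - 1\<close> and the resulting bounds on
  \<open>z f'/f\<close>\<close>

text \<open>Since \<open>sqrt (a^2 + b^2) \<le> a + b\<close>, the range of \<open>l\<close> in the
  first conjunct lies within the range of part (1).\<close>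

theorem theorem2:
  fixes n :: nat and f L :: "complex \<Rightarrow> complex" and mu lam :: complex
  assumes "n \<ge> 1"
    and "class_A n f"
    and "\<forall>z\<in>unit_disc - {0}. f z \<noteq> 0"
    and "mu \<noteq> 0" and "Re mu < real n / 2"
    and "lam \<noteq> 0"
    and "log_branch f L"
    and "subord_lin (\<lambda>z. deriv f z * exp ((1 + mu) * L z)) lam"
  defines "a \<equiv> cmod (of_nat n - mu)" and "b \<equiv> cmod mu" and "l \<equiv> cmod lam"
  defines "l1 \<equiv> l * b / a"
  shows "(0 < l \<and> l \<le> a / (a + b) \<longrightarrow>
            (\<forall>z\<in>unit_disc. Re (starlike_quot f z) > (1 - l) / (1 + l1)))
       \<and> (a / (a + b) \<le> l \<and> l \<le> a / sqrt (a\<^sup>2 + b\<^sup>2) \<longrightarrow>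
            (\<forall>z\<in>unit_disc. Re (starlike_quot f z) > (1 - (l\<^sup>2 + l1\<^sup>2)) / (2 * (1 - l1\<^sup>2))))
       \<and> (0 < l \<and> l \<le> a / (a + 2 * b) \<longrightarrow>
            (\<forall>z\<in>unit_disc. cmod (starlike_quot f z - 1) < (a + b) * l / (a - b * l))
            \<and> (a + b) * l / (a - b * l) \<le> 1)"
proof -
  define q where "q z = deriv f z * exp ((1 + mu) * L z)" for z
  define P where "P z = exp (mu * L z)" for z
  have q: "cmod (q z - 1) < l" if "z \<in> unit_disc" for z
    using assms(8) that by (simp add: subord_lin_def q_def l_def)
  have fh: "f holomorphic_on unit_disc" and f1: "deriv f 0 = 1"
    using assms(2) by (auto simp: class_A_def)
  have Lh: "L holomorphic_on unit_disc" and L0: "L 0 = 0"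
    and Le: "\<And>z. z \<in> unit_disc \<Longrightarrow> exp (L z) = z_over_f f z"
    using assms(7) by (auto simp: log_branch_def)
  \<comment> \<open>\<open>Re mu < n/2 < n\<close> excludes \<open>mu = n\<close>, so
    \<open>a > 0\<close>.\<close>
  have pos: "a > 0" "b > 0" "l > 0"
    using assms(1,4,5,6) by (auto simp: a_def b_def l_def)
  have qP: "q z = P z * starlike_quot f z" if z: "z \<in> unit_disc" for z
  proof -
    have "q z = P z * (exp (L z) * deriv f z)"
      by (simp add: q_def P_def ring_distribs exp_add)
    also have "exp (L z) * deriv f z = starlike_quot f z"
      using Le[OF z] f1 by (auto simp: starlike_quot_def z_over_f_def)
    finally show ?thesis .
  qed
  have P: "cmod (P z1 - 1) < l1" if z1: "z1 \<in> unit_disc" for z1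
  proof (rule ccontr)
    define W where "W z = P z - 1" for z
    assume "\<not> ?thesis"
    then have ge: "cmod (W z1) \<ge> l1" by (simp add: W_def)
    have l1: "l1 > 0" using pos by (simp add: l1_def)
    then have W1: "W z1 \<noteq> 0" using ge by auto
    then have "z1 \<noteq> 0" using L0 by (auto simp: W_def P_def)
    moreover obtain u where "u holomorphic_on unit_disc" "\<And>z. z \<in> unit_disc \<Longrightarrow> W z = z ^ n * u z"
      using log_branch_power_factor[OF assms(2,1,3,7), of mu] unfolding W_def P_def by blast
    ultimately obtain z c where z: "z \<in> unit_disc" "cmod (W z) \<ge> cmod (W z1)" "c \<ge> real n"
      and zW: "z * deriv W z = of_real c * W z"
      using jack_lemma z1 W1 by blast
    have "(W has_field_derivative P z * (mu * deriv L z)) (at z)"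
      unfolding W_def P_def
      by (auto intro!: derivative_eq_intros holomorphic_derivI[OF Lh open_ball z(1)])
    then have "of_real c * W z = mu * (P z * (z * deriv L z))"
      using zW by (simp add: DERIV_imp_deriv mult_ac)
    also have "P z * (z * deriv L z) = P z - q z"
      unfolding mult_deriv_log_branch[OF fh assms(3,7) z(1)] qP[OF z(1)] by (simp add: algebra_simps)
    also have "\<dots> = W z - (q z - 1)" by (simp add: W_def)
    finally have "mu * (q z - 1) = - ((of_real c - mu) * W z)" by (simp add: algebra_simps)
    then have "b * cmod (q z - 1) = cmod (of_real c - mu) * cmod (W z)"
      unfolding b_def by (metis norm_minus_cancel norm_mult)
    \<comment> \<open>The real numbers \<open>n \<le> c\<close> both lie to the right of
      \<open>Re mu\<close>, so \<open>c\<close> is at least as far from \<open>mu\<close> as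
      \<open>n\<close> is.\<close>
    moreover have "a \<le> cmod (of_real c - mu)"
    proof -
      have "(Re (of_nat n - mu))\<^sup>2 \<le> (Re (of_real c - mu))\<^sup>2"
        using z(3) assms(5) by (intro power_mono) auto
      then show ?thesis unfolding a_def cmod_def by simp
    qed
    then have "a * l1 \<le> cmod (of_real c - mu) * cmod (W z)"
      using ge z(2) l1 pos by (intro mult_mono) auto
    \<comment> \<open>This is where the value of \<open>l1\<close> comes from: the chain closes to
      \<open>b * l \<le> b * |q - 1| < b * l\<close>.\<close>
    moreover have "a * l1 = b * l" using pos by (simp add: l1_def)
    moreover have "b * cmod (q z - 1) < b * l" using q[OF z(1)] pos by simp
    ultimately show False by linarith
  qed
  have sq: "starlike_quot f z = q z / P z" if "z \<in> unit_disc" for z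
    using qP[OF that] by (simp add: P_def)
  have small: "l + l1 \<le> 1" if "l \<le> a / (a + b)"
    using that pos by (simp add: l1_def field_simps)
  have large: "l1 < 1" if "l \<le> a / sqrt (a\<^sup>2 + b\<^sup>2)"
  proof -
    have "b < sqrt (a\<^sup>2 + b\<^sup>2)" using pos by (intro real_less_rsqrt) simp
    then have "a * b < a * sqrt (a\<^sup>2 + b\<^sup>2)" using pos by simp
    moreover have s: "sqrt (a\<^sup>2 + b\<^sup>2) > 0" using pos by (simp add: add_pos_pos)
    have "l * b \<le> a / sqrt (a\<^sup>2 + b\<^sup>2) * b" using that pos by (intro mult_right_mono) auto
    ultimately have "l * b < a" using s
      by (smt (verit) divide_less_eq mult.commute times_divide_eq_left)
    then show ?thesis using pos by (simp add: l1_def)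
  qed
  have disc: "cmod (starlike_quot f z - 1) < (a + b) * l / (a - b * l)"
    "(a + b) * l / (a - b * l) \<le> 1" if l: "l \<le> a / (a + 2 * b)" and z: "z \<in> unit_disc" for z
  proof -
    \<comment> \<open>Moving one \<open>b * l\<close> to the right gives both the positive
      denominator and the bound by 1.\<close>
    have "l * (a + 2 * b) \<le> a" using l pos by (simp add: field_simps)
    then have le: "(a + b) * l \<le> a - b * l" by (simp add: algebra_simps)
    then have d: "a - b * l > 0" using pos by (smt (verit) mult_pos_pos)
    then show "(a + b) * l / (a - b * l) \<le> 1" using le by simp
    have l1: "l1 < 1" using d pos by (simp add: l1_def mult.commute)
    have Pn: "cmod (P z) > 1 - l1"
      using P[OF z] norm_triangle_ineq2[of 1 "1 - P z"] by (simp add: norm_minus_commute)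
    have "cmod (q z - P z) < l + l1"
      using norm_triangle_ineq4[of "q z - 1" "P z - 1"] P[OF z] q[OF z] by simp
    moreover have "starlike_quot f z - 1 = (q z - P z) / P z"
      using sq[OF z] by (simp add: P_def diff_divide_distrib)
    ultimately have "cmod (starlike_quot f z - 1) < (l + l1) / (1 - l1)"
      using Pn l1 by (auto simp: norm_divide intro!: frac_less)
    also have "\<dots> = (a + b) * l / (a - b * l)"
      using pos l1 d by (simp add: l1_def field_simps)
    finally show "cmod (starlike_quot f z - 1) < (a + b) * l / (a - b * l)" .
  qed
  \<comment> \<open>The numerical half of \<open>disc\<close> is stated for a point of the disc; the
    origin serves as one.\<close>
  have "0 \<in> unit_disc" by simp
  show ?thesis
    using Re_divide_gt_small[OF q less_imp_le[OF P] pos(3) small] Re_divide_gt_large[OF q less_imp_le[OF P] large]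
      disc disc(2)[OF _ \<open>0 \<in> unit_disc\<close>] sq by simp
qed

end
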